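(* Let $n\ge k\geq 2$ be integers, and let $(X,\mathcal{H})$ be a hypergraph with $|X|=n$ which contains no edge $H\in \mathcal{H}$ of cardinality smaller than $k$. If $\mathcal{H}$ crosses all $k$-partitions of $X$, then $$\sum_{H\in \mathcal{H}} \binom{|H|}{k}\frac{1}{|H|-k+2} \;\geq\; \binom{n}{k}\frac{1}{n-k+2}.$$
   Context: A hypergraph $(X,\mathcal{H})$ consists of a finite vertex set $X$ and a set $\mathcal{H}$ of subsets of $X$ (the edges); it need not be uniform. A $k$-partition of $X$ is a partition $\mathcal{P}=(X_1,\dots,X_k)$ of $X$ into precisely $k$ nonempty classes. A set $H\subseteq X$ crosses $\mathcal{P}$ if $H$ intersects exactly $\min(|H|,k)$ of the classes. A hypergraph $\mathcal{H}$ crosses $\mathcal{P}$ if at least one edge $H\in\mathcal{H}$ crosses $\mathcal{P}$. *)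

theory Defs
  imports Complex_Main "HOL-Library.Disjoint_Sets"
begin

definition hypergraph :: "'a set \<Rightarrow> 'a set set \<Rightarrow> bool" where
  "hypergraph X \<H> \<longleftrightarrow> finite X \<and> \<H> \<subseteq> Pow X"

(* The order of the classes plays no role for crossing, so a partition (X_1, ..., X_k)
   is represented by its set of classes; partition_on makes them nonempty. *)
definition k_partition :: "nat \<Rightarrow> 'a set \<Rightarrow> 'a set set \<Rightarrow> bool" where
  "k_partition k X \<P> \<longleftrightarrow> partition_on X \<P> \<and> finite \<P> \<and> card \<P> = k"

definition set_crosses :: "'a set \<Rightarrow> 'a set set \<Rightarrow> bool" where
  "set_crosses H \<P> \<longleftrightarrow> card {C \<in> \<P>. H \<inter> C \<noteq> {}} = min (card H) (card \<P>)"

definition hypergraph_crosses :: "'a set set \<Rightarrow> 'a set set \<Rightarrow> bool" where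
  "hypergraph_crosses \<H> \<P> \<longleftrightarrow> (\<exists>H\<in>\<H>. set_crosses H \<P>)"

end

theory Submission
  imports Defs
begin

text \<open>
  For \<open>k = 2\<close> the hypothesis says that the hypergraph is connected, and the claim doubled is
  \<open>(\<Sum>H\<in>\<H>. card H - 1) \<ge> n - 1\<close>: when a connected component is grown edge by edge, an edge \<open>H\<close>
  that meets what has been reached adds at most \<open>card H - 1\<close> vertices
  (\<open>connected_imp_sum_card_ge\<close>).

  The general case reduces to this one through links. Fix a set \<open>S\<close> of \<open>k - 2\<close> vertices and consider
  only the \<open>k\<close>-partitions that have every vertex of \<open>S\<close> as a singleton class. The other two classes
  split \<open>X - S\<close> arbitrarily, and as edges have at least \<open>k\<close> vertices, an edge crossing such a
  partition meets all its classes: it contains \<open>S\<close>, and its trace on \<open>X - S\<close> meets both parts. So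
  the traces of the edges containing \<open>S\<close> form a connected hypergraph on \<open>X - S\<close>, which gives
  \<open>(\<Sum>H | S \<subseteq> H. card H - k + 1) \<ge> n - k + 1\<close> (\<open>link_sum_ge\<close>).

  Summing over all \<open>S\<close> counts each edge once for each of its \<open>(k - 2)\<close>-subsets. Both sides then
  consist of terms \<open>(h choose (k - 2)) * (h - k + 1)\<close>, and this is \<open>k * (k - 1)\<close> times the weight
  \<open>(h choose k) / (h - k + 2)\<close> of the theorem (\<open>choose_weight_eq\<close>).
\<close>

text \<open>
  A largest vertex set \<open>W\<close> that satisfies the bound with respect to the edges inside \<open>W\<close> must be
  all of \<open>V\<close>: otherwise some edge \<open>A\<close> leaves \<open>W\<close>, and \<open>W \<union> A\<close> still satisfies the bound, because
  \<open>A\<close> is a new edge and shares a vertex with \<open>W\<close>.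
\<close>

lemma connected_imp_sum_card_ge:
  fixes V :: "'a set"
  assumes V: "finite V" "V \<noteq> {}" and E: "E \<subseteq> Pow V"
    and conn: "\<And>W. W \<noteq> {} \<Longrightarrow> W \<subset> V \<Longrightarrow> \<exists>A\<in>E. A \<inter> W \<noteq> {} \<and> A - W \<noteq> {}"
  shows "card V \<le> 1 + (\<Sum>A\<in>E. card A - 1)"
proof -
  define Good where
    "Good = {W. W \<noteq> {} \<and> W \<subseteq> V \<and> card W \<le> 1 + (\<Sum>A | A \<in> E \<and> A \<subseteq> W. card A - 1)}"
  have finE: "finite E" using E V(1) by (meson finite_Pow_iff finite_subset)
  have "finite Good" by (rule finite_subset[of _ "Pow V"]) (use V in \<open>auto simp: Good_def\<close>)
  moreover obtain v where "v \<in> V" using V(2) by blast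
  then have "{v} \<in> Good" by (auto simp: Good_def)
  ultimately obtain W where W: "W \<in> Good" and maximal: "\<And>U. U \<in> Good \<Longrightarrow> W \<subseteq> U \<Longrightarrow> U = W"
    using finite_has_maximal[of Good] by blast
  have "W = V"
  proof (rule ccontr)
    assume "W \<noteq> V"
    with W have "W \<noteq> {}" "W \<subset> V" by (auto simp: Good_def)
    then obtain A where A: "A \<in> E" "A \<inter> W \<noteq> {}" "A - W \<noteq> {}"
      using conn[of W] by auto
    have AV: "A \<subseteq> V" using A(1) E by blast
    have fin: "finite W" "finite A"
      using \<open>W \<subset> V\<close> AV V(1) by (auto intro: finite_subset)
    have "card W + card A = card (W \<union> A) + card (W \<inter> A)" using card_Un_Int fin by blast
    moreover have "card (W \<inter> A) \<ge> 1"
      using A(2) fin by (simp add: Suc_le_eq card_gt_0_iff Int_commute)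
    ultimately have "card (W \<union> A) \<le> card W + (card A - 1)" by linarith
    also have "\<dots> \<le> 1 + ((\<Sum>B | B \<in> E \<and> B \<subseteq> W. card B - 1) + (card A - 1))"
      using W by (simp add: Good_def)
    also have "(\<Sum>B | B \<in> E \<and> B \<subseteq> W. card B - 1) + (card A - 1)
        = (\<Sum>B \<in> insert A {B \<in> E. B \<subseteq> W}. card B - 1)"
      using finE A(3) by (subst sum.insert) auto
    also have "\<dots> \<le> (\<Sum>B | B \<in> E \<and> B \<subseteq> W \<union> A. card B - 1)"
      by (rule sum_mono2) (use finE A(1) in auto)
    finally have "W \<union> A \<in> Good"
      using \<open>W \<noteq> {}\<close> \<open>W \<subset> V\<close> AV by (auto simp: Good_def)
    with maximal A(3) show False by blast
  qed
  moreover have "{A. A \<in> E \<and> A \<subseteq> V} = E" using E by blast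
  ultimately show ?thesis using W by (simp add: Good_def)
qed

lemma k_partition_singletons_and_split:
  assumes "finite X" "S \<subseteq> X" "W \<noteq> {}" "W \<subset> X - S"
  shows "k_partition (card S + 2) X (insert W (insert (X - S - W) ((\<lambda>x. {x}) ` S)))"
proof -
  have fS: "finite S" using assms finite_subset by blast
  have "W \<noteq> X - S - W" "W \<notin> (\<lambda>x. {x}) ` S" "X - S - W \<notin> (\<lambda>x. {x}) ` S"
    using assms by auto
  moreover have "card ((\<lambda>x. {x}) ` S) = card S" by (rule card_image) auto
  ultimately have "card (insert W (insert (X - S - W) ((\<lambda>x. {x}) ` S))) = card S + 2"
    using fS by simp
  moreover have "partition_on X (insert W (insert (X - S - W) ((\<lambda>x. {x}) ` S)))"
    unfolding partition_on_def disjoint_def using assms by auto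
  ultimately show ?thesis using fS by (simp add: k_partition_def)
qed

text \<open>
  An edge with at least as many vertices as there are classes crosses a partition only by meeting
  every class.
\<close>

lemma set_crosses_imp_meets_class:
  assumes "set_crosses H \<P>" "finite \<P>" "card \<P> \<le> card H" "C \<in> \<P>"
  shows "H \<inter> C \<noteq> {}"
proof -
  have "card {C \<in> \<P>. H \<inter> C \<noteq> {}} = card \<P>"
    using assms by (simp add: set_crosses_def)
  then have "{C \<in> \<P>. H \<inter> C \<noteq> {}} = \<P>"
    using card_subset_eq[OF assms(2), of "{C \<in> \<P>. H \<inter> C \<noteq> {}}"] by blast
  with assms(4) show ?thesis by blast
qed

text \<open>
  The bound for connected hypergraphs, applied to the link of \<open>S\<close>, that is, to the sets \<open>H - S\<close> on
  the vertex set \<open>X - S\<close> where \<open>H\<close> runs over the edges containing \<open>S\<close>.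
\<close>

lemma link_sum_ge:
  assumes X: "finite X" and \<H>: "\<H> \<subseteq> Pow X"
    and large: "\<And>H. H \<in> \<H> \<Longrightarrow> card S + 2 \<le> card H"
    and cross: "\<And>\<P>. k_partition (card S + 2) X \<P> \<Longrightarrow> hypergraph_crosses \<H> \<P>"
    and S: "S \<subset> X"
  shows "card X - card S - 1 \<le> (\<Sum>H | H \<in> \<H> \<and> S \<subseteq> H. card H - card S - 1)"
proof -
  let ?L = "{H \<in> \<H>. S \<subseteq> H}"
  have fS: "finite S" using S X finite_subset by blast
  have "card (X - S) \<le> 1 + (\<Sum>A \<in> (\<lambda>H. H - S) ` ?L. card A - 1)"
  proof (rule connected_imp_sum_card_ge)
    fix W assume W: "W \<noteq> {}" "W \<subset> X - S"
    let ?P = "insert W (insert (X - S - W) ((\<lambda>x. {x}) ` S))"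
    have P: "k_partition (card S + 2) X ?P"
      using k_partition_singletons_and_split X S W by blast
    then obtain H where H: "H \<in> \<H>" "set_crosses H ?P"
      using cross by (auto simp: hypergraph_crosses_def)
    have meets: "H \<inter> C \<noteq> {}" if "C \<in> ?P" for C
      using set_crosses_imp_meets_class[OF H(2) _ _ that] P large[OF H(1)]
      by (simp add: k_partition_def)
    have "S \<subseteq> H" using meets by auto
    moreover have "(H - S) \<inter> W \<noteq> {}" using meets[of W] W by auto
    moreover have "(H - S) - W \<noteq> {}" using meets[of "X - S - W"] by auto
    ultimately show "\<exists>A\<in>(\<lambda>H. H - S) ` ?L. A \<inter> W \<noteq> {} \<and> A - W \<noteq> {}"
      using H(1) by (intro bexI[of _ "H - S"] conjI imageI CollectI)
  qed (use X S \<H> in auto)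
  also have "(\<Sum>A \<in> (\<lambda>H. H - S) ` ?L. card A - 1) = (\<Sum>H \<in> ?L. card (H - S) - 1)"
    by (subst sum.reindex) (auto simp: inj_on_def)
  also have "\<dots> = (\<Sum>H \<in> ?L. card H - card S - 1)"
    by (rule sum.cong) (auto simp: card_Diff_subset[OF fS])
  finally show ?thesis using S by (simp add: card_Diff_subset[OF fS])
qed

lemma Suc_times_choose_Suc: "Suc i * (h choose Suc i) = (h - i) * (h choose i)"
  using binomial_absorb_comp[of h i] binomial_absorption[of i h] by simp

lemma choose_weight_eq:
  assumes "2 \<le> k" "k \<le> h"
  shows "real (h choose k) * (1 / (real h - real k + 2))
    = real ((h choose (k - 2)) * (h - (k - 2) - 1)) / (real k * (real k - 1))"
proof -
  obtain j where k: "k = Suc (Suc j)" using assms(1) by (metis add_2_eq_Suc le_Suc_ex)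
  obtain m where h: "h = k + m" using assms(2) le_Suc_ex by blast
  have diffs: "h - j = m + 2" "h - Suc j = m + 1" "k - 2 = j" by (simp_all add: h k)
  have "Suc j * (Suc (Suc j) * (h choose k)) = Suc j * ((m + 1) * (h choose Suc j))"
    by (simp only: k Suc_times_choose_Suc diffs)
  also have "\<dots> = (m + 1) * (Suc j * (h choose Suc j))" by (rule mult.left_commute)
  also have "\<dots> = (m + 1) * ((m + 2) * (h choose j))"
    by (simp only: Suc_times_choose_Suc diffs)
  finally have "real (Suc j * (Suc (Suc j) * (h choose k)))
      = real ((m + 1) * ((m + 2) * (h choose j)))" by (rule arg_cong)
  then have absorb: "(real j + 1) * (real j + 2) * real (h choose k)
      = (real m + 1) * (real m + 2) * real (h choose j)"
    by (simp add: algebra_simps)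
  have weight: "real ((h choose (k - 2)) * (h - (k - 2) - 1)) = real (h choose j) * (real m + 1)"
    by (simp add: diffs algebra_simps)
  have denominators: "real h - real k + 2 = real m + 2"
      "real k * (real k - 1) = (real j + 1) * (real j + 2)"
    by (simp add: h) (simp add: k algebra_simps)
  have "real m + 2 \<noteq> 0" "(real j + 1) * (real j + 2) \<noteq> 0" by auto
  then show ?thesis
    unfolding weight denominators using absorb by (simp add: frac_eq_eq mult_ac)
qed

theorem theorem7:
  fixes X :: "'a set" and \<H> :: "'a set set" and n k :: nat
  assumes "k \<ge> 2" and "n \<ge> k"
    and "hypergraph X \<H>" and "card X = n"
    and "\<forall>H\<in>\<H>. \<not> card H < k"
    and "\<forall>\<P>. k_partition k X \<P> \<longrightarrow> hypergraph_crosses \<H> \<P>"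
  shows "(\<Sum>H\<in>\<H>. real (card H choose k) * (1 / (real (card H) - real k + 2)))
           \<ge> real (n choose k) * (1 / (real n - real k + 2))"
proof -
  have X: "finite X" and \<H>: "\<H> \<subseteq> Pow X"
    using assms(3) by (auto simp: hypergraph_def)
  then have fin\<H>: "finite \<H>" by (meson finite_Pow_iff finite_subset)
  let ?S = "{S. S \<subseteq> X \<and> card S = k - 2}"
  let ?w = "\<lambda>h. h - (k - 2) - 1"
  have fin_S: "finite ?S" using X by simp
  have link: "?w n \<le> (\<Sum>H | H \<in> \<H> \<and> S \<subseteq> H. ?w (card H))" if "S \<in> ?S" for S
  proof -
    have S: "S \<subset> X" "card S = k - 2" "card S + 2 = k"
      using that assms(1,2,4) by auto
    have "card X - card S - 1 \<le> (\<Sum>H | H \<in> \<H> \<and> S \<subseteq> H. card H - card S - 1)"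
      by (rule link_sum_ge) (use X \<H> S assms(5,6) in \<open>auto simp: not_less\<close>)
    then show ?thesis using S(2) assms(4) by simp
  qed
  have "(n choose (k - 2)) * ?w n = (\<Sum>S\<in>?S. ?w n)"
    using n_subsets[OF X, of "k - 2"] assms(4) by simp
  also have "\<dots> \<le> (\<Sum>S\<in>?S. \<Sum>H | H \<in> \<H> \<and> S \<subseteq> H. ?w (card H))"
    by (rule sum_mono) (rule link)
  also have "\<dots> = (\<Sum>H\<in>\<H>. \<Sum>S | S \<in> ?S \<and> S \<subseteq> H. ?w (card H))"
    by (rule sum.swap_restrict[OF fin_S fin\<H>])
  also have "\<dots> = (\<Sum>H\<in>\<H>. (card H choose (k - 2)) * ?w (card H))"
  proof (rule sum.cong)
    fix H assume "H \<in> \<H>"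
    then have "H \<subseteq> X" using \<H> by blast
    then have "{S \<in> ?S. S \<subseteq> H} = {S. S \<subseteq> H \<and> card S = k - 2}" and "finite H"
      using X finite_subset by auto
    then show "(\<Sum>S | S \<in> ?S \<and> S \<subseteq> H. ?w (card H)) = (card H choose (k - 2)) * ?w (card H)"
      using n_subsets[of H "k - 2"] by simp
  qed simp
  finally have count: "real ((n choose (k - 2)) * ?w n)
      \<le> real (\<Sum>H\<in>\<H>. (card H choose (k - 2)) * ?w (card H))" by (rule of_nat_mono)
  have "real (n choose k) * (1 / (real n - real k + 2))
      = real ((n choose (k - 2)) * ?w n) / (real k * (real k - 1))"
    by (rule choose_weight_eq) (use assms in auto)
  also have "\<dots> \<le> real (\<Sum>H\<in>\<H>. (card H choose (k - 2)) * ?w (card H)) / (real k * (real k - 1))"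
    by (rule divide_right_mono[OF count]) (use assms(1) in auto)
  also have "\<dots> = (\<Sum>H\<in>\<H>. real ((card H choose (k - 2)) * ?w (card H)) / (real k * (real k - 1)))"
    by (simp only: of_nat_sum sum_divide_distrib)
  also have "\<dots> = (\<Sum>H\<in>\<H>. real (card H choose k) * (1 / (real (card H) - real k + 2)))"
    by (intro sum.cong refl choose_weight_eq[symmetric]) (use assms(1,5) in \<open>auto simp: not_less\<close>)
  finally show ?thesis .
qed

end
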